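(* There exists a strictly convex function $F:[0,1]\to\mathbb{R}$ such that, if $E$ denotes the set of all one-sided tangent lines of $F$, then the union $\bigcup E\subset\mathbb{R}^2$ of these lines has Hausdorff dimension $1$.
   Context: For a convex function $F:[0,1]\to\mathbb{R}$, the one-sided derivatives exist everywhere (left and right derivatives at points of $(0,1)$, right derivative at $0$, left derivative at $1$), if the values $\pm\infty$ are allowed. A one-sided tangent line of $F$ at $x_0\in[0,1]$ is the (full) line in $\mathbb{R}^2$ through $(x_0,F(x_0))$ whose slope is a left or right derivative of $F$ at $x_0$ (the vertical line through this point if that one-sided derivative is infinite). At a point where $F$ is differentiable, the one-sided tangent lines coincide with the ordinary tangent line. The set $E$ consists of all one-sided tangent lines at all points $x_0\in[0,1]$. *)

theory Defs
  imports "HOL-Analysis.Analysis"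
begin

definition strictly_convex_on :: "'a::real_vector set \<Rightarrow> ('a \<Rightarrow> real) \<Rightarrow> bool" where
  "strictly_convex_on S f \<longleftrightarrow>
     convex S \<and>
     (\<forall>x\<in>S. \<forall>y\<in>S. \<forall>t. x \<noteq> y \<and> 0 < t \<and> t < 1 \<longrightarrow>
        f ((1 - t) *\<^sub>R x + t *\<^sub>R y) < (1 - t) * f x + t * f y)"

(* The limits are taken in ereal, so the values \<infinity> and -\<infinity> are allowed. *)

definition has_right_derivative :: "(real \<Rightarrow> real) \<Rightarrow> ereal \<Rightarrow> real \<Rightarrow> bool" where
  "has_right_derivative F d x \<longleftrightarrow>
     ((\<lambda>y. ereal ((F y - F x) / (y - x))) \<longlongrightarrow> d) (at_right x)"

definition has_left_derivative :: "(real \<Rightarrow> real) \<Rightarrow> ereal \<Rightarrow> real \<Rightarrow> bool" where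
  "has_left_derivative F d x \<longleftrightarrow>
     ((\<lambda>y. ereal ((F y - F x) / (y - x))) \<longlongrightarrow> d) (at_left x)"

definition line_with_slope :: "real \<times> real \<Rightarrow> ereal \<Rightarrow> (real \<times> real) set" where
  "line_with_slope p d =
     (if \<bar>d\<bar> = \<infinity> then {q. fst q = fst p}
      else {q. snd q = snd p + real_of_ereal d * (fst q - fst p)})"

(* A function on [0,1] is represented by a total function on the reals. Only right derivatives
   at points of [0,1) and left derivatives at points of (0,1] are used, and these do not depend
   on the values outside [0,1]. *)
definition one_sided_tangent_lines :: "(real \<Rightarrow> real) \<Rightarrow> (real \<times> real) set set" where
  "one_sided_tangent_lines F =
     {line_with_slope (x, F x) d | x d.
        0 \<le> x \<and> x < 1 \<and> has_right_derivative F d x} \<union>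
     {line_with_slope (x, F x) d | x d.
        0 < x \<and> x \<le> 1 \<and> has_left_derivative F d x}"

(* The power (diam U)^s with the usual conventions that the empty set contributes 0 and that,
   for s = 0, every nonempty set contributes 1 (whereas 0 powr 0 = 0). *)
definition diameter_power :: "real \<Rightarrow> 'a::metric_space set \<Rightarrow> ennreal" where
  "diameter_power s U =
     (if U = {} then 0 else if s = 0 then 1 else ennreal (diameter U powr s))"

(* Boundedness is required explicitly because diameter is meaningless (in the type real) for
   unbounded sets. Finite covers are included: pad with empty sets. *)
definition countable_delta_covers :: "real \<Rightarrow> 'a::metric_space set \<Rightarrow> (nat \<Rightarrow> 'a set) set" where
  "countable_delta_covers \<delta> A =
     {U. A \<subseteq> (\<Union>n. U n) \<and> (\<forall>n. bounded (U n) \<and> diameter (U n) \<le> \<delta>)}"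

definition hausdorff_outer_measure :: "real \<Rightarrow> 'a::metric_space set \<Rightarrow> ennreal" where
  "hausdorff_outer_measure s A =
     (SUP \<delta>\<in>{0<..}. INF U\<in>countable_delta_covers \<delta> A. \<Sum>n. diameter_power s (U n))"

definition hausdorff_dimension :: "'a::metric_space set \<Rightarrow> ennreal" where
  "hausdorff_dimension A = Inf {ennreal s | s. 0 \<le> s \<and> hausdorff_outer_measure s A = 0}"

end

theory Submission
  imports Defs
begin

text \<open>
  The function is $F(x) = \sum_n 2^{-n^2} |x - q_n|$, where $q_0, q_1, \ldots$ enumerates a dense
  subset of $[0,1]$. It is strictly convex because every interval contains a kink $q_n$, and a
  kink strictly between two points makes the chord inequality for them strict. On the other hand
  its derivative is a pure jump function with very rapidly decreasing jumps, so the slopes that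
  occur form a very small set, and so do the tangent lines.

  To make this quantitative, split $F$ after $N$ terms. The partial sum is piecewise affine, and
  an affine piece is determined by the set of those $n < N$ with $q_n$ to its left, so there are
  at most $2^N$ pieces. The remainder is at most $\varepsilon_N = 2 \cdot 2^{-N^2}$ on $[0,1]$ and
  has Lipschitz constant $\varepsilon_N$. Next to a point $x$, on either side, the
  partial sum coincides with one of its pieces. So a one-sided derivative of $F$ at $x$ differs
  from the slope of that piece by at most $\varepsilon_N$, and over a bounded interval the tangent
  line stays within a constant multiple of $\varepsilon_N$ of the line that extends the piece
  (\<open>tangent_line_near_piece\<close>).

  Hence a bounded part of the union of the tangent lines lies in $2^N$ strips of width
  $O(\varepsilon_N)$. Each strip is covered by $O(1/\varepsilon_N)$ sets of diameter
  $O(\varepsilon_N)$. For $s > 1$ the resulting sum of $s$-th powers of diameters is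
  $O(2^N \varepsilon_N^{s-1})$, which tends to $0$ (\<open>tangent_lines_null\<close>). So the
  dimension is at most $1$. It is at least $1$ because the union contains a non-vertical line,
  which projects onto the whole first coordinate axis
  (\<open>hausdorff_not_null_if_projection_UNIV\<close>).
\<close>

section \<open>Null sets of Hausdorff measures\<close>

lemma hausdorff_outer_measure_eq_0_iff:
  "hausdorff_outer_measure s A = 0 \<longleftrightarrow>
     (\<forall>\<delta>>0. \<forall>e>0. \<exists>U\<in>countable_delta_covers \<delta> A. (\<Sum>n. diameter_power s (U n)) < e)"
  by (auto simp: hausdorff_outer_measure_def SUP_eq_iff INF_eq_bot_iff simp flip: bot_ennreal)

lemma diameter_power_empty [simp]: "diameter_power s {} = 0"
  by (simp add: diameter_power_def)

text \<open>
  A cover of the \<open>k\<close>-th set with sum below \<open>r / 2 ^ Suc k\<close> is chosen for each \<open>k\<close>; the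
  pairing function merges these covers into a single sequence with sum at most \<open>r\<close>.
\<close>
lemma hausdorff_null_UN:
  fixes A :: "nat \<Rightarrow> 'a::metric_space set"
  assumes null: "\<And>k. hausdorff_outer_measure s (A k) = 0"
  shows "hausdorff_outer_measure s (\<Union>k. A k) = 0"
  unfolding hausdorff_outer_measure_eq_0_iff
proof (intro allI impI)
  fix \<delta> :: real and e :: ennreal
  assume "\<delta> > 0" "e > 0"
  obtain r where r: "0 < r" "ennreal r < e"
    using \<open>e > 0\<close> by (metis dense ennreal_cases ennreal_less_zero_iff less_top_ennreal order_less_trans ennreal_less_top)
  define b where "b k = ennreal (r * (1/2) ^ Suc k)" for k
  have "\<exists>U\<in>countable_delta_covers \<delta> (A k). (\<Sum>n. diameter_power s (U n)) < b k" for k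
    using null[of k] \<open>\<delta> > 0\<close> \<open>0 < r\<close>
    unfolding hausdorff_outer_measure_eq_0_iff b_def by simp
  then obtain U where U: "\<And>k. U k \<in> countable_delta_covers \<delta> (A k)"
      "\<And>k. (\<Sum>n. diameter_power s (U k n)) < b k"
    by metis
  define V where "V i = (case prod_decode i of (k, n) \<Rightarrow> U k n)" for i
  have V_eq: "V (prod_encode (k, n)) = U k n" for k n
    by (simp add: V_def)
  have "V \<in> countable_delta_covers \<delta> (\<Union>k. A k)"
    unfolding countable_delta_covers_def
  proof (intro CollectI conjI allI)
    show "(\<Union>k. A k) \<subseteq> (\<Union>i. V i)"
    proof
      fix x assume "x \<in> (\<Union>k. A k)"
      then obtain k where "x \<in> A k" by blast
      moreover have "A k \<subseteq> (\<Union>n. U k n)"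
        using U(1)[of k] by (simp add: countable_delta_covers_def)
      ultimately obtain n where "x \<in> U k n" by blast
      then have "x \<in> V (prod_encode (k, n))" by (simp only: V_eq)
      then show "x \<in> (\<Union>i. V i)" by blast
    qed
    show "bounded (V i)" "diameter (V i) \<le> \<delta>" for i
      using U(1) unfolding countable_delta_covers_def V_def by (auto split: prod.split)
  qed
  moreover have "(\<Sum>i. diameter_power s (V i)) = (\<Sum>k. \<Sum>n. diameter_power s (U k n))"
    unfolding V_def
    by (rule suminf_ennreal_2dimen[where f = "\<lambda>p. diameter_power s (case p of (k, n) \<Rightarrow> U k n)"]) simp
  moreover have "\<dots> \<le> (\<Sum>k. b k)"
    using U(2) by (intro suminf_le) (auto simp: less_imp_le)
  moreover have "(\<Sum>k. b k) = ennreal r"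
  proof -
    have "(\<lambda>k. r * (1/2) ^ Suc k) sums (r * 1)"
      by (intro sums_mult power_half_series)
    then show ?thesis
      unfolding b_def using \<open>0 < r\<close> by (intro suminf_ennreal_eq) auto
  qed
  ultimately show "\<exists>V\<in>countable_delta_covers \<delta> (\<Union>k. A k). (\<Sum>n. diameter_power s (V n)) < e"
    using r(2) by (metis order_le_less_trans)
qed

text \<open>
  This is the form in which covers arise below: finitely many sets with a common bound \<open>d\<close> on
  their diameters, so that the sum of powers is at most a cardinality times \<open>d powr s\<close>. Here
  \<open>s > 0\<close> ensures that \<open>d powr s\<close> is monotone in \<open>d\<close>.
\<close>
lemma hausdorff_null_if_finite_covers:
  fixes A :: "'a::metric_space set"
  assumes "s > 0"
    and cov: "\<And>e. e > 0 \<Longrightarrow> \<exists>\<U> d. finite \<U> \<and> A \<subseteq> \<Union>\<U> \<and> d \<le> e \<and>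
           (\<forall>U\<in>\<U>. bounded U \<and> diameter U \<le> d) \<and> real (card \<U>) * d powr s < e"
  shows "hausdorff_outer_measure s A = 0"
  unfolding hausdorff_outer_measure_eq_0_iff
proof (intro allI impI)
  fix \<delta> :: real and e :: ennreal
  assume "\<delta> > 0" "e > 0"
  obtain r where r: "0 < r" "ennreal r < e"
    using \<open>e > 0\<close> by (metis dense ennreal_cases ennreal_less_zero_iff less_top_ennreal order_less_trans ennreal_less_top)
  obtain \<U> d where \<U>: "finite \<U>" "A \<subseteq> \<Union>\<U>" "d \<le> min \<delta> r"
      "\<And>U. U \<in> \<U> \<Longrightarrow> bounded U" "\<And>U. U \<in> \<U> \<Longrightarrow> diameter U \<le> d"
      "real (card \<U>) * d powr s < min \<delta> r"
    using cov[of "min \<delta> r"] \<open>\<delta> > 0\<close> \<open>0 < r\<close> by auto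
  obtain f where f: "bij_betw f {..<card \<U>} \<U>"
    using ex_bij_betw_nat_finite[OF \<U>(1)] by (auto simp: atLeast0LessThan)
  \<comment> \<open>Empty sets, which cost nothing, turn the finite family into a sequence.\<close>
  define V where "V n = (if n < card \<U> then f n else {})" for n
  have V: "V n \<in> \<U>" if "n < card \<U>" for n
    using that f by (auto simp: V_def bij_betw_def)
  have "\<exists>n. U = V n" if "U \<in> \<U>" for U
  proof -
    have "U \<in> f ` {..<card \<U>}"
      using f that by (simp add: bij_betw_def)
    then obtain n where "n < card \<U>" "U = f n" by auto
    then show ?thesis by (intro exI[of _ n]) (simp add: V_def)
  qed
  then have "\<Union>\<U> \<subseteq> (\<Union>n. V n)" by blast
  with \<U>(2) have "A \<subseteq> (\<Union>n. V n)" by (rule subset_trans)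
  moreover have "bounded (V n) \<and> diameter (V n) \<le> \<delta>" for n
  proof (cases "n < card \<U>")
    case True
    then show ?thesis using V[OF True] \<U>(3-5) by fastforce
  next
    case False
    then show ?thesis using \<open>\<delta> > 0\<close> by (simp add: V_def)
  qed
  ultimately have "V \<in> countable_delta_covers \<delta> A"
    by (simp add: countable_delta_covers_def)
  moreover have "(\<Sum>n. diameter_power s (V n)) < e"
  proof -
    have "(\<Sum>n. diameter_power s (V n)) = (\<Sum>n<card \<U>. diameter_power s (V n))"
      by (intro suminf_finite) (auto simp: V_def)
    also have "\<dots> \<le> (\<Sum>n<card \<U>. ennreal (d powr s))"
      using V \<U>(4,5) \<open>s > 0\<close>
      by (intro sum_mono) (auto simp: diameter_power_def intro!: ennreal_leI powr_mono2 diameter_ge_0)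
    also have "\<dots> = ennreal (real (card \<U>) * d powr s)"
      by (simp add: ennreal_mult ennreal_of_nat_eq_real_of_nat)
    also have "\<dots> \<le> ennreal r"
      using \<U>(6) by (intro ennreal_leI) auto
    finally show ?thesis
      using r(2) by simp
  qed
  ultimately show "\<exists>V\<in>countable_delta_covers \<delta> A. (\<Sum>n. diameter_power s (V n)) < e"
    by blast
qed

section \<open>A set that meets every vertical line\<close>

text \<open>
  A cover of \<open>A\<close> by sets of diameter at most \<open>1\<close> projects to a cover of \<open>{0..1}\<close> by sets that lie
  in intervals of length twice the diameters. Lebesgue measure bounds the sum of the diameters
  from below by \<open>1/2\<close>, and a number in \<open>[0, 1]\<close> only grows when it is raised to a power
  \<open>s < 1\<close>.
\<close>
lemma hausdorff_not_null_if_projection_UNIV: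
  fixes A :: "(real \<times> real) set"
  assumes "fst ` A = UNIV" "0 \<le> s" "s < 1"
  shows "hausdorff_outer_measure s A \<noteq> 0"
proof
  assume "hausdorff_outer_measure s A = 0"
  then obtain U where U: "U \<in> countable_delta_covers 1 A"
      "(\<Sum>n. diameter_power s (U n)) < ennreal (1/2)"
    unfolding hausdorff_outer_measure_eq_0_iff by (metis ennreal_less_zero_iff half_gt_zero zero_less_one)
  define I where "I n = (if U n = {} then {} else cball (fst (SOME p. p \<in> U n)) (diameter (U n)))" for n
  have UI: "fst ` U n \<subseteq> I n" for n
  proof
    fix x assume "x \<in> fst ` U n"
    then obtain p where p: "p \<in> U n" "x = fst p" by blast
    then have o: "(SOME p. p \<in> U n) \<in> U n" by (metis someI)
    have "bounded (U n)"
      using U(1) by (simp add: countable_delta_covers_def)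
    then have "dist (SOME p. p \<in> U n) p \<le> diameter (U n)"
      using o p(1) by (rule diameter_bounded_bound)
    with p show "x \<in> I n"
      using dist_fst_le[of "SOME p. p \<in> U n" p] by (auto simp: I_def)
  qed
  have I_small: "emeasure lborel (I n) \<le> 2 * diameter_power s (U n)" for n
  proof (cases "U n = {}")
    case False
    have D: "0 \<le> diameter (U n)" "diameter (U n) \<le> 1"
      using U(1) by (auto simp: countable_delta_covers_def intro: diameter_ge_0)
    have "ennreal (diameter (U n)) \<le> diameter_power s (U n)"
    proof (cases "s = 0")
      case True
      then show ?thesis using D False by (simp add: diameter_power_def)
    next
      case s: False
      have "diameter (U n) \<le> diameter (U n) powr s"
      proof (cases "diameter (U n) = 0")
        case False
        then have "diameter (U n) powr 1 \<le> diameter (U n) powr s"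
          using D assms by (intro powr_mono') auto
        then show ?thesis using D by simp
      qed auto
      then show ?thesis
        using s False by (simp add: diameter_power_def ennreal_leI)
    qed
    moreover have "emeasure lborel (I n) = 2 * ennreal (diameter (U n))"
      using False D by (simp add: I_def cball_eq_atLeastAtMost ennreal_mult flip: mult_2)
    ultimately show ?thesis
      by (simp add: mult_left_mono)
  qed (simp add: I_def)
  have "{0..1} \<subseteq> (\<Union>n. I n)"
  proof
    fix x :: real
    obtain p where "p \<in> A" "x = fst p" using assms(1) by blast
    then show "x \<in> (\<Union>n. I n)"
      using U(1) UI unfolding countable_delta_covers_def by blast
  qed
  then have "emeasure lborel {0..1::real} \<le> emeasure lborel (\<Union>n. I n)"
    by (intro emeasure_mono) (auto simp: I_def)
  also have "\<dots> \<le> (\<Sum>n. emeasure lborel (I n))"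
    by (intro emeasure_subadditive_countably) (auto simp: I_def)
  also have "\<dots> \<le> (\<Sum>n. 2 * diameter_power s (U n))"
    by (intro suminf_le I_small) auto
  also have "\<dots> = 2 * (\<Sum>n. diameter_power s (U n))"
    by simp
  also have "\<dots> < 2 * ennreal (1/2)"
    using U(2) by (intro ennreal_mult_strict_left_mono) auto
  also have "2 * ennreal (1/2) = ennreal 2 * ennreal (1/2)"
    by simp
  also have "\<dots> = ennreal (2 * (1/2))"
    by (rule ennreal_mult[symmetric]) auto
  finally show False by simp
qed

section \<open>Sets lying in few thin strips\<close>

definition strip :: "real \<Rightarrow> real \<Rightarrow> real \<Rightarrow> real \<Rightarrow> (real \<times> real) set" where
  "strip R w p c = {(x, y). \<bar>x\<bar> \<le> R \<and> \<bar>y - (p * x + c)\<bar> \<le> w}"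

text \<open>
  Cutting the strip by vertical lines at distance \<open>w\<close> produces about \<open>2 * R / w\<close> parallelograms
  of width \<open>w\<close> and height at most \<open>(M + 2) * w\<close>.
\<close>
lemma strip_cover:
  assumes "0 < w" "w \<le> 1" "0 \<le> R" "\<bar>p\<bar> \<le> M"
  shows "\<exists>\<U>. finite \<U> \<and> strip R w p c \<subseteq> \<Union>\<U> \<and> real (card \<U>) \<le> (2 * R + 3) / w \<and>
           (\<forall>U\<in>\<U>. bounded U \<and> diameter U \<le> (M + 3) * w)"
proof -
  define m where "m = nat \<lceil>R / w\<rceil>"
  define B where "B j = {(x, y). real_of_int j * w \<le> x \<and> x \<le> (real_of_int j + 1) * w \<and> \<bar>y - (p * x + c)\<bar> \<le> w}" for j
  have dist_B: "dist u v \<le> (M + 3) * w" if "u \<in> B j" "v \<in> B j" for u v j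
  proof -
    have "\<bar>fst u - fst v\<bar> \<le> w"
      using that by (auto simp: B_def algebra_simps)
    moreover have "\<bar>snd u - snd v\<bar> \<le> 2 * w + M * w"
    proof -
      have "\<bar>p * (fst u - fst v)\<bar> \<le> M * w"
        unfolding abs_mult using assms \<open>\<bar>fst u - fst v\<bar> \<le> w\<close> by (intro mult_mono) auto
      then show ?thesis
        using that by (auto simp: B_def algebra_simps)
    qed
    ultimately show ?thesis
      using sqrt_sum_squares_le_sum_abs[of "fst u - fst v" "snd u - snd v"]
      by (simp add: dist_prod_def dist_real_def algebra_simps)
  qed
  have "strip R w p c \<subseteq> (\<Union>j\<in>{-int m..int m}. B j)"
  proof
    fix z assume "z \<in> strip R w p c"
    then obtain x y where z: "z = (x, y)" "\<bar>x\<bar> \<le> R" "\<bar>y - (p * x + c)\<bar> \<le> w"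
      by (auto simp: strip_def)
    define j where "j = \<lfloor>x / w\<rfloor>"
    have j: "real_of_int j \<le> x / w" "x / w < real_of_int j + 1"
      by (auto simp: j_def)
    have "\<bar>x / w\<bar> \<le> R / w"
      unfolding abs_divide using z(2) assms by (simp add: divide_right_mono)
    moreover have "R / w \<le> real m"
      unfolding m_def by (rule real_nat_ceiling_ge)
    ultimately have "real_of_int j \<le> real_of_int (int m)" "real_of_int (- int m) < real_of_int (j + 1)"
      unfolding of_int_minus of_int_add of_int_of_nat_eq of_int_1 using j by linarith+
    then have "j \<in> {-int m..int m}"
      unfolding of_int_le_iff of_int_less_iff by auto
    moreover have "z \<in> B j"
      using j z assms by (auto simp: B_def field_simps)
    ultimately show "z \<in> (\<Union>j\<in>{-int m..int m}. B j)" by blast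
  qed
  moreover have "real (card (B ` {-int m..int m})) \<le> (2 * R + 3) / w"
  proof -
    have "card (B ` {-int m..int m}) \<le> 2 * m + 1"
      by (rule order_trans[OF card_image_le]) auto
    then have "real (card (B ` {-int m..int m})) \<le> 2 * real m + 1"
      by linarith
    also have "real m = real_of_int \<lceil>R / w\<rceil>"
      using assms by (simp add: m_def)
    also have "\<dots> \<le> R / w + 1"
      by (rule of_int_ceiling_le_add_one)
    also have "2 * (R / w + 1) + 1 \<le> (2 * R + 3) / w"
      using assms by (simp add: field_simps)
    finally show ?thesis by simp
  qed
  moreover have "bounded (B j) \<and> diameter (B j) \<le> (M + 3) * w" for j
  proof
    show "bounded (B j)"
      unfolding bounded_two_points using dist_B by blast
    show "diameter (B j) \<le> (M + 3) * w"
    proof (rule diameter_le)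
      show "B j \<noteq> {} \<or> 0 \<le> (M + 3) * w"
        using assms by auto
    qed (use dist_B in \<open>auto simp: dist_norm\<close>)
  qed
  ultimately show ?thesis
    by (intro exI[of _ "B ` {-int m..int m}"]) auto
qed

text \<open>
  A strip of width \<open>w\<close> is essentially one-dimensional at scale \<open>w\<close>: it needs of the order of
  \<open>1 / w\<close> sets of diameter of the order of \<open>w\<close>, which together contribute about
  \<open>w powr (s - 1)\<close>. So the number of strips only has to grow more slowly than this tends to \<open>0\<close>.
\<close>
lemma hausdorff_null_if_strip_covers:
  fixes A :: "(real \<times> real) set" and w :: "nat \<Rightarrow> real"
  assumes "1 < s" "0 \<le> R" "\<And>N. 0 < w N" "w \<longlonglongrightarrow> 0"
    and L: "\<And>N. finite (L N)" "\<And>N p c. (p, c) \<in> L N \<Longrightarrow> \<bar>p\<bar> \<le> M"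
    and lim: "(\<lambda>N. real (card (L N)) * w N powr (s - 1)) \<longlonglongrightarrow> 0"
    and cov: "\<And>N. A \<subseteq> (\<Union>(p, c)\<in>L N. strip R (w N) p c)"
  shows "hausdorff_outer_measure s A = 0"
proof (rule hausdorff_null_if_finite_covers)
  show "s > 0" using \<open>1 < s\<close> by simp
next
  fix e :: real assume "e > 0"
  define M' where "M' = \<bar>M\<bar> + 3"
  have lim1: "(\<lambda>N. M' * w N) \<longlonglongrightarrow> M' * 0"
    by (intro tendsto_intros assms)
  have lim2: "(\<lambda>N. (2 * R + 3) * M' powr s * (real (card (L N)) * w N powr (s - 1))) \<longlonglongrightarrow> 
                (2 * R + 3) * M' powr s * 0"
    by (intro tendsto_mult_left lim)
  have "\<forall>\<^sub>F N in sequentially. M' * w N < e"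
    "\<forall>\<^sub>F N in sequentially. (2 * R + 3) * M' powr s * (real (card (L N)) * w N powr (s - 1)) < e"
    "\<forall>\<^sub>F N in sequentially. w N < 1"
    using order_tendstoD(2)[OF lim1, of e] order_tendstoD(2)[OF lim2, of e]
      order_tendstoD(2)[OF \<open>w \<longlonglongrightarrow> 0\<close>, of 1] \<open>e > 0\<close> by auto
  then have "\<forall>\<^sub>F N in sequentially. M' * w N < e \<and> w N < 1 \<and>
      (2 * R + 3) * M' powr s * (real (card (L N)) * w N powr (s - 1)) < e"
    by eventually_elim auto
  then obtain N where N: "M' * w N < e" "w N < 1"
      "(2 * R + 3) * M' powr s * (real (card (L N)) * w N powr (s - 1)) < e"
    by (auto simp: eventually_sequentially)
  have "\<exists>\<U>. finite \<U> \<and> strip R (w N) (fst l) (snd l) \<subseteq> \<Union>\<U> \<and>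
      real (card \<U>) \<le> (2 * R + 3) / w N \<and> (\<forall>U\<in>\<U>. bounded U \<and> diameter U \<le> M' * w N)"
    if "l \<in> L N" for l
    unfolding M'_def
  proof (rule strip_cover)
    show "\<bar>fst l\<bar> \<le> \<bar>M\<bar>"
      using L(2)[of "fst l" "snd l" N] that by simp
  qed (use N assms less_imp_le in auto)
  then obtain C where C: "\<And>l. l \<in> L N \<Longrightarrow> finite (C l)"
     "\<And>l. l \<in> L N \<Longrightarrow> strip R (w N) (fst l) (snd l) \<subseteq> \<Union>(C l)"
     "\<And>l. l \<in> L N \<Longrightarrow> real (card (C l)) \<le> (2 * R + 3) / w N"
     "\<And>l U. l \<in> L N \<Longrightarrow> U \<in> C l \<Longrightarrow> bounded U \<and> diameter U \<le> M' * w N"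
    by metis
  define \<U> where "\<U> = (\<Union>l\<in>L N. C l)"
  have "real (card \<U>) \<le> (\<Sum>l\<in>L N. real (card (C l)))"
    unfolding \<U>_def of_nat_sum[symmetric] of_nat_le_iff by (intro card_UN_le L)
  also have "\<dots> \<le> (\<Sum>l\<in>L N. (2 * R + 3) / w N)"
    by (intro sum_mono C(3))
  finally have "real (card \<U>) * (M' * w N) powr s \<le> real (card (L N)) * ((2 * R + 3) / w N) * (M' * w N) powr s"
    by (intro mult_right_mono) auto
  also have "\<dots> = (2 * R + 3) * M' powr s * (real (card (L N)) * w N powr (s - 1))"
    using \<open>0 < w N\<close> by (simp add: M'_def powr_mult powr_diff)
  also have "\<dots> < e" by (rule N)
  finally have "real (card \<U>) * (M' * w N) powr s < e" .
  moreover have "A \<subseteq> \<Union>\<U>"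
  proof
    fix z assume "z \<in> A"
    then obtain l where l: "l \<in> L N" "z \<in> strip R (w N) (fst l) (snd l)"
      using cov[of N] by fastforce
    with C(2)[OF l(1)] show "z \<in> \<Union>\<U>"
      unfolding \<U>_def by blast
  qed
  ultimately show "\<exists>\<U> d. finite \<U> \<and> A \<subseteq> \<Union>\<U> \<and> d \<le> e \<and>
      (\<forall>U\<in>\<U>. bounded U \<and> diameter U \<le> d) \<and> real (card \<U>) * d powr s < e"
    using N C L(1) unfolding \<U>_def
    by (intro exI[of _ "\<Union>l\<in>L N. C l"] exI[of _ "M' * w N"]) (auto intro: less_imp_le)
qed

section \<open>Superexponentially decreasing weights\<close>

text \<open>
  The exponent is quadratic so that the weights beat the crude bound \<open>2 ^ N\<close> for the number of
  affine pieces, even after they are raised to an arbitrarily small positive power.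
\<close>
definition weight :: "nat \<Rightarrow> real" where
  "weight n = (1/2) ^ (n\<^sup>2)"

lemma weight_pos: "0 < weight n"
  by (simp add: weight_def)

lemma weight_add_le: "weight (n + N) \<le> weight N * (1/2) ^ n"
proof -
  have "n \<le> n\<^sup>2"
    by (simp add: power2_eq_square)
  then have "N\<^sup>2 + n \<le> (n + N)\<^sup>2"
    by (simp add: power2_sum)
  then have "(1/2::real) ^ (n + N)\<^sup>2 \<le> (1/2) ^ (N\<^sup>2 + n)"
    by (intro power_decreasing) auto
  then show ?thesis
    by (simp add: weight_def power_add)
qed

lemma summable_weight: "summable (\<lambda>n. weight (n + N))"
proof (rule summable_comparison_test')
  show "summable (\<lambda>n. weight N * (1/2) ^ n)"
    by (intro summable_mult summable_geometric) auto
  show "norm (weight (n + N)) \<le> weight N * (1/2) ^ n" if "n \<ge> 0" for n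
    using weight_add_le weight_pos[of "n + N"] by simp
qed

lemma suminf_weight_le: "(\<Sum>n. weight (n + N)) \<le> 2 * weight N"
proof -
  have "(\<lambda>n. weight N * (1/2) ^ n) sums (weight N * (1 / (1 - 1/2)))"
    by (intro sums_mult geometric_sums) auto
  then have "(\<lambda>n. weight N * (1/2) ^ n) sums (2 * weight N)"
    by (simp add: mult.commute)
  then show ?thesis
    using suminf_le[OF weight_add_le summable_weight] by (metis sums_iff)
qed

lemma weight_tendsto_0: "weight \<longlonglongrightarrow> 0"
  using summable_LIMSEQ_zero[OF summable_weight[of 0]] by simp

lemma weight_powr: "weight N powr t = 2 powr (- (t * real N * real N))"
proof -
  have "weight N = 2 powr (- real (N\<^sup>2))"
    by (simp add: weight_def powr_minus powr_realpow power_one_over inverse_eq_divide del: of_nat_power)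
  then have "weight N = 2 powr (- (real N * real N))"
    by (simp add: power2_eq_square)
  then show ?thesis
    by (simp add: powr_powr mult_ac)
qed

lemma power2_mult_weight_powr_tendsto_0:
  assumes "0 < t"
  shows "(\<lambda>N. 2 ^ N * weight N powr t) \<longlonglongrightarrow> 0"
proof (rule tendsto_sandwich[where f = "\<lambda>_. 0"])
  \<comment> \<open>From here on the exponent \<open>N - t * N * N\<close> of \<open>2\<close> is at most \<open>- N\<close>.\<close>
  obtain K :: nat where K: "2 / t \<le> real K"
    using real_arch_simple by blast
  have "2 ^ N * weight N powr t \<le> (1/2) ^ N" if "N \<ge> K" for N
  proof -
    have "2 \<le> t * real N"
      using K that assms by (simp add: field_simps) (smt (verit) mult_left_mono of_nat_le_iff)
    then have "2 * real N \<le> t * real N * real N"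
      by (intro mult_right_mono) auto
    have "2 ^ N * weight N powr t = 2 powr (real N - t * real N * real N)"
      by (simp add: weight_powr powr_diff powr_minus powr_realpow divide_inverse)
    also have "\<dots> \<le> 2 powr (- real N)"
      using \<open>2 * real N \<le> t * real N * real N\<close> by (intro powr_mono) auto
    also have "\<dots> = (1/2) ^ N"
      by (simp add: powr_minus powr_realpow power_one_over inverse_eq_divide)
    finally show ?thesis .
  qed
  then show "\<forall>\<^sub>F N in sequentially. 2 ^ N * weight N powr t \<le> (1/2) ^ N"
    by (auto simp: eventually_sequentially)
  show "(\<lambda>N. (1/2) ^ N :: real) \<longlonglongrightarrow> 0"
    by (rule LIMSEQ_power_zero) auto
  show "\<forall>\<^sub>F N in sequentially. 0 \<le> 2 ^ N * weight N powr t"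
    by simp
qed (rule tendsto_const)

section \<open>A convex function with a dense set of kinks\<close>

context
  fixes q :: "nat \<Rightarrow> real"
  assumes q_range: "q n \<in> {0..1}"
begin

definition kinked :: "real \<Rightarrow> real" where
  "kinked x = (\<Sum>n. weight n * \<bar>x - q n\<bar>)"

definition head :: "nat \<Rightarrow> real \<Rightarrow> real" where
  "head N x = (\<Sum>n<N. weight n * \<bar>x - q n\<bar>)"

definition tail :: "nat \<Rightarrow> real \<Rightarrow> real" where
  "tail N x = (\<Sum>n. weight (n + N) * \<bar>x - q (n + N)\<bar>)"

text \<open>
  Slope and constant term of the affine function that agrees with \<open>head N\<close> at the points lying
  to the right of \<open>q n\<close> for \<open>n \<in> S\<close> and to the left of \<open>q n\<close> for the other \<open>n < N\<close>. No such
  points need exist; the pair is defined for every set \<open>S\<close>, and there are \<open>2 ^ N\<close> choices that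
  matter.
\<close>
definition piece_slope :: "nat \<Rightarrow> nat set \<Rightarrow> real" where
  "piece_slope N S = (\<Sum>n<N. if n \<in> S then weight n else - weight n)"

definition piece_const :: "nat \<Rightarrow> nat set \<Rightarrow> real" where
  "piece_const N S = (\<Sum>n<N. if n \<in> S then - (weight n * q n) else weight n * q n)"

lemma summable_tail: "summable (\<lambda>n. weight (n + N) * \<bar>x - q (n + N)\<bar>)"
proof (rule summable_comparison_test')
  show "summable (\<lambda>n. weight (n + N) * (\<bar>x\<bar> + 1))"
    by (intro summable_mult2 summable_weight)
  show "norm (weight (n + N) * \<bar>x - q (n + N)\<bar>) \<le> weight (n + N) * (\<bar>x\<bar> + 1)" if "n \<ge> 0" for n
    using weight_pos[of "n + N"] q_range[of "n + N"] by (auto simp: abs_mult)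
qed

lemma kinked_eq: "kinked x = head N x + tail N x"
  unfolding kinked_def head_def tail_def
  using suminf_split_initial_segment[OF summable_tail[of 0 x, simplified], of N] by simp

lemma tail_lipschitz: "\<bar>tail N x - tail N y\<bar> \<le> 2 * weight N * \<bar>x - y\<bar>"
proof -
  have bound: "norm (weight (n + N) * \<bar>x - q (n + N)\<bar> - weight (n + N) * \<bar>y - q (n + N)\<bar>)
      \<le> weight (n + N) * \<bar>x - y\<bar>" for n
    unfolding right_diff_distrib[symmetric] real_norm_def abs_mult
    using weight_pos[of "n + N"] by (intro mult_mono) auto
  have sm: "summable (\<lambda>n. weight (n + N) * \<bar>x - y\<bar>)"
    by (intro summable_mult2 summable_weight)
  have "\<bar>tail N x - tail N y\<bar>
      = norm (\<Sum>n. weight (n + N) * \<bar>x - q (n + N)\<bar> - weight (n + N) * \<bar>y - q (n + N)\<bar>)"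
    unfolding tail_def by (simp add: suminf_diff[OF summable_tail summable_tail])
  also have "\<dots> \<le> (\<Sum>n. weight (n + N) * \<bar>x - y\<bar>)"
    by (rule norm_suminf_le[OF bound sm]) 
  also have "\<dots> = (\<Sum>n. weight (n + N)) * \<bar>x - y\<bar>"
    by (rule suminf_mult2[symmetric, OF summable_weight])
  also have "\<dots> \<le> 2 * weight N * \<bar>x - y\<bar>"
    by (intro mult_right_mono suminf_weight_le) auto
  finally show ?thesis .
qed

lemma abs_tail_le:
  assumes "x \<in> {0..1}"
  shows "\<bar>tail N x\<bar> \<le> 2 * weight N"
proof -
  have "weight (n + N) * \<bar>x - q (n + N)\<bar> \<le> weight (n + N) * 1" for n
    using weight_pos[of "n + N"] q_range[of "n + N"] assms by (intro mult_left_mono) auto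
  then have "tail N x \<le> (\<Sum>n. weight (n + N))"
    unfolding tail_def by (intro suminf_le summable_tail summable_weight) auto
  moreover have "0 \<le> tail N x"
    unfolding tail_def by (intro suminf_nonneg summable_tail) (simp add: weight_pos less_imp_le)
  ultimately show ?thesis
    using suminf_weight_le[of N] by simp
qed

lemma abs_piece_slope_le: "\<bar>piece_slope N S\<bar> \<le> 2"
proof -
  have "\<bar>piece_slope N S\<bar> \<le> (\<Sum>n<N. weight n)"
    unfolding piece_slope_def by (rule order_trans[OF sum_abs]) (auto intro!: sum_mono simp: weight_pos less_imp_le)
  also have "\<dots> \<le> (\<Sum>n. weight n)"
    using summable_weight[of 0] by (intro sum_le_suminf) (auto simp: weight_pos less_imp_le)
  also have "\<dots> \<le> 2"
    using suminf_weight_le[of 0] by (simp add: weight_def)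
  finally show ?thesis .
qed

lemma head_eq_piece:
  assumes "\<And>n. n < N \<Longrightarrow> \<bar>y - q n\<bar> = (if n \<in> S then y - q n else q n - y)"
  shows "head N y = piece_slope N S * y + piece_const N S"
  unfolding head_def piece_slope_def piece_const_def sum_distrib_right sum.distrib[symmetric]
  by (intro sum.cong) (auto simp: assms algebra_simps)

text \<open>
  Where \<open>head N\<close> is affine, the difference quotients of \<open>kinked\<close> and of this affine function
  differ by a difference quotient of \<open>tail N\<close>, which the Lipschitz bound controls. This
  passes to the limit and also shows that the limit is finite. The filter \<open>G\<close> stands for
  \<open>at_right x\<close> or \<open>at_left x\<close>.
\<close>
lemma derivative_near_piece_slope:
  assumes G: "G \<noteq> bot" "\<forall>\<^sub>F y in G. y \<noteq> x"
    and near: "\<forall>\<^sub>F y in G. head N y = piece_slope N S * y + piece_const N S"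
    and at: "head N x = piece_slope N S * x + piece_const N S"
    and lim: "((\<lambda>y. ereal ((kinked y - kinked x) / (y - x))) \<longlongrightarrow> d) G"
  obtains r where "d = ereal r" "\<bar>r - piece_slope N S\<bar> \<le> 2 * weight N"
proof -
  define p where "p = piece_slope N S"
  define e where "e = 2 * weight N"
  have "\<forall>\<^sub>F y in G. \<bar>(kinked y - kinked x) / (y - x) - p\<bar> \<le> e"
    using G(2) near
  proof eventually_elim
    case (elim y)
    have "(kinked y - kinked x) / (y - x) - p = (tail N y - tail N x) / (y - x)"
      using elim at by (simp add: kinked_eq[of _ N] p_def field_simps)
    also have "\<bar>\<dots>\<bar> \<le> e"
      using tail_lipschitz[of N y x] elim by (simp add: abs_div e_def divide_le_eq)
    finally show ?case .
  qed
  then have "\<forall>\<^sub>F y in G. ereal (p - e) \<le> ereal ((kinked y - kinked x) / (y - x))"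
    "\<forall>\<^sub>F y in G. ereal ((kinked y - kinked x) / (y - x)) \<le> ereal (p + e)"
    by (auto elim!: eventually_mono)
  then have "ereal (p - e) \<le> d" "d \<le> ereal (p + e)"
    using tendsto_lowerbound[OF lim _ G(1)] tendsto_upperbound[OF lim _ G(1)] by auto
  then show thesis
    using that by (cases d) (auto simp: p_def e_def)
qed

text \<open>
  The relevant piece is the one just to the right of \<open>x\<close>: a kink at \<open>x\<close> itself counts as lying to
  the left of it. For left derivatives it is the other way round.
\<close>
lemma right_derivative_near_piece:
  assumes "has_right_derivative kinked d x"
  obtains S r where "S \<subseteq> {..<N}" "d = ereal r" "\<bar>r - piece_slope N S\<bar> \<le> 2 * weight N"
    "head N x = piece_slope N S * x + piece_const N S"
proof -
  define S where "S = {n. n < N \<and> q n \<le> x}"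
  have at: "head N x = piece_slope N S * x + piece_const N S"
    by (rule head_eq_piece) (auto simp: S_def)
  have "\<forall>\<^sub>F y in at_right x. \<bar>y - q n\<bar> = (if n \<in> S then y - q n else q n - y)" if "n < N" for n
  proof (cases "q n \<le> x")
    case True
    then show ?thesis
      using eventually_at_right_less[of x] that by (auto simp: S_def elim!: eventually_mono)
  next
    case False
    then have "\<forall>\<^sub>F y in at_right x. y < q n"
      by (intro order_tendstoD(2)[OF tendsto_ident_at]) auto
    with False show ?thesis
      by (auto simp: S_def elim!: eventually_mono)
  qed
  then have "\<forall>\<^sub>F y in at_right x. \<forall>n\<in>{..<N}. \<bar>y - q n\<bar> = (if n \<in> S then y - q n else q n - y)"
    by (intro eventually_ball_finite) auto
  then have "\<forall>\<^sub>F y in at_right x. head N y = piece_slope N S * y + piece_const N S"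
    by eventually_elim (auto intro: head_eq_piece)
  moreover have "\<forall>\<^sub>F y in at_right x. y \<noteq> x"
    using eventually_at_right_less[of x] by eventually_elim auto
  ultimately obtain r where "d = ereal r" "\<bar>r - piece_slope N S\<bar> \<le> 2 * weight N"
    using derivative_near_piece_slope[of "at_right x" x N S d] at assms
    unfolding has_right_derivative_def by auto
  moreover have "S \<subseteq> {..<N}" by (auto simp: S_def)
  ultimately show thesis using that at by blast
qed

lemma left_derivative_near_piece:
  assumes "has_left_derivative kinked d x"
  obtains S r where "S \<subseteq> {..<N}" "d = ereal r" "\<bar>r - piece_slope N S\<bar> \<le> 2 * weight N"
    "head N x = piece_slope N S * x + piece_const N S"
proof -
  define S where "S = {n. n < N \<and> q n < x}"
  have below: "\<forall>\<^sub>F y in at_left x. y < x"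
    by (simp add: eventually_at_filter)
  have at: "head N x = piece_slope N S * x + piece_const N S"
    by (rule head_eq_piece) (auto simp: S_def)
  have "\<forall>\<^sub>F y in at_left x. \<bar>y - q n\<bar> = (if n \<in> S then y - q n else q n - y)" if "n < N" for n
  proof (cases "q n < x")
    case True
    then have "\<forall>\<^sub>F y in at_left x. q n < y"
      by (intro order_tendstoD(1)[OF tendsto_ident_at]) auto
    with True that show ?thesis
      by (auto simp: S_def elim!: eventually_mono)
  next
    case False
    then show ?thesis
      using below by (auto simp: S_def elim!: eventually_mono)
  qed
  then have "\<forall>\<^sub>F y in at_left x. \<forall>n\<in>{..<N}. \<bar>y - q n\<bar> = (if n \<in> S then y - q n else q n - y)"
    by (intro eventually_ball_finite) auto
  then have "\<forall>\<^sub>F y in at_left x. head N y = piece_slope N S * y + piece_const N S"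
    by eventually_elim (auto intro: head_eq_piece)
  moreover have "\<forall>\<^sub>F y in at_left x. y \<noteq> x"
    using below by eventually_elim auto
  ultimately obtain r where "d = ereal r" "\<bar>r - piece_slope N S\<bar> \<le> 2 * weight N"
    using derivative_near_piece_slope[of "at_left x" x N S d] at assms
    unfolding has_left_derivative_def by auto
  moreover have "S \<subseteq> {..<N}" by (auto simp: S_def)
  ultimately show thesis using that at by blast
qed

text \<open>
  At \<open>x\<close> the tangent line deviates from the extended piece by \<open>tail N x\<close>, and the slopes differ by
  at most \<open>2 * weight N\<close>; since \<open>x\<close> lies in \<open>{0..1}\<close>, the distance from \<open>u\<close> to \<open>x\<close> is at most
  \<open>R + 1\<close>.
\<close>
lemma tangent_line_near_piece:
  assumes "l \<in> one_sided_tangent_lines kinked" "(u, v) \<in> l" "\<bar>u\<bar> \<le> R"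
  shows "\<exists>S\<subseteq>{..<N}. \<bar>v - (piece_slope N S * u + piece_const N S)\<bar> \<le> 2 * weight N * (R + 2)"
proof -
  obtain x d where "0 \<le> x" "x \<le> 1" and l: "l = line_with_slope (x, kinked x) d"
    and d: "has_right_derivative kinked d x \<or> has_left_derivative kinked d x"
    using assms(1) unfolding one_sided_tangent_lines_def by (blast intro: less_imp_le)
  then have x: "x \<in> {0..1}" by simp
  obtain S r where S: "S \<subseteq> {..<N}" and r: "d = ereal r" "\<bar>r - piece_slope N S\<bar> \<le> 2 * weight N"
    and at: "head N x = piece_slope N S * x + piece_const N S"
    using d left_derivative_near_piece right_derivative_near_piece by metis
  have "v = kinked x + r * (u - x)"
    using assms(2) by (simp add: l r(1) line_with_slope_def)
  then have "v - (piece_slope N S * u + piece_const N S) = tail N x + (r - piece_slope N S) * (u - x)"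
    by (simp add: kinked_eq[of _ N] at algebra_simps)
  also have "\<bar>\<dots>\<bar> \<le> \<bar>tail N x\<bar> + \<bar>r - piece_slope N S\<bar> * \<bar>u - x\<bar>"
    unfolding abs_mult[symmetric] by (rule abs_triangle_ineq)
  also have "\<dots> \<le> 2 * weight N + 2 * weight N * (R + 1)"
    using abs_tail_le[OF x] r(2) x assms(3) by (intro add_mono mult_mono) auto
  also have "\<dots> = 2 * weight N * (R + 2)"
    by (simp add: algebra_simps)
  finally show ?thesis
    using S by blast
qed

lemma tangent_lines_null:
  assumes "1 < s"
  shows "hausdorff_outer_measure s (\<Union>(one_sided_tangent_lines kinked)) = 0"
proof -
  define E where "E = \<Union>(one_sided_tangent_lines kinked)"
  \<comment> \<open>The strips follow the tangent lines only over bounded intervals, so the plane is exhausted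
    by vertical slabs.\<close>
  have "hausdorff_outer_measure s (E \<inter> {z. \<bar>fst z\<bar> \<le> real k}) = 0" for k
  proof (rule hausdorff_null_if_strip_covers[OF assms])
    define R where "R = real k"
    define L where "L N = (\<lambda>S. (piece_slope N S, piece_const N S)) ` Pow {..<N}" for N
    define w where "w N = 2 * weight N * (R + 2)" for N
    show "0 \<le> R" by (simp add: R_def)
    show "0 < w N" for N using weight_pos \<open>0 \<le> R\<close> by (simp add: w_def)
    have "w \<longlonglongrightarrow> 2 * 0 * (R + 2)"
      unfolding w_def by (intro tendsto_intros weight_tendsto_0)
    then show "w \<longlonglongrightarrow> 0" by simp
    show "finite (L N)" for N by (simp add: L_def)
    show "\<bar>p\<bar> \<le> 2" if "(p, c) \<in> L N" for N p c
      using that abs_piece_slope_le by (auto simp: L_def)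
    show "(\<lambda>N. real (card (L N)) * w N powr (s - 1)) \<longlonglongrightarrow> 0"
    proof (rule tendsto_sandwich[where f = "\<lambda>_. 0"])
      have "real (card (L N)) * w N powr (s - 1) \<le> (2 * (R + 2)) powr (s - 1) * (2 ^ N * weight N powr (s - 1))" for N
      proof -
        have "card (L N) \<le> 2 ^ N"
          unfolding L_def by (rule order_trans[OF card_image_le]) (auto simp: card_Pow)
        then have "real (card (L N)) \<le> 2 ^ N"
          by (metis of_nat_le_iff of_nat_numeral of_nat_power)
        moreover have "w N powr (s - 1) = (2 * (R + 2)) powr (s - 1) * weight N powr (s - 1)"
          using weight_pos[of N] \<open>0 \<le> R\<close> by (simp add: w_def powr_mult[symmetric] mult_ac)
        ultimately show ?thesis
          by (simp add: mult_right_mono mult_left_mono mult_ac)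
      qed
      then show "\<forall>\<^sub>F N in sequentially. real (card (L N)) * w N powr (s - 1) \<le>
          (2 * (R + 2)) powr (s - 1) * (2 ^ N * weight N powr (s - 1))"
        by simp
      show "(\<lambda>N. (2 * (R + 2)) powr (s - 1) * (2 ^ N * weight N powr (s - 1))) \<longlonglongrightarrow> 0"
        using assms by (intro tendsto_mult_right_zero power2_mult_weight_powr_tendsto_0) simp
    qed auto
    show "E \<inter> {z. \<bar>fst z\<bar> \<le> real k} \<subseteq> (\<Union>(p, c)\<in>L N. strip R (w N) p c)" for N
    proof
      fix z assume z: "z \<in> E \<inter> {z. \<bar>fst z\<bar> \<le> real k}"
      obtain u v where uv: "z = (u, v)" by (cases z)
      with z obtain l where "l \<in> one_sided_tangent_lines kinked" "(u, v) \<in> l" "\<bar>u\<bar> \<le> R"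
        by (auto simp: E_def R_def)
      from tangent_line_near_piece[OF this, of N] obtain S where "S \<subseteq> {..<N}"
        "(u, v) \<in> strip R (w N) (piece_slope N S) (piece_const N S)"
        using \<open>\<bar>u\<bar> \<le> R\<close> by (auto simp: strip_def w_def)
      then show "z \<in> (\<Union>(p, c)\<in>L N. strip R (w N) p c)"
        unfolding L_def uv by blast
    qed
  qed
  then have "hausdorff_outer_measure s (\<Union>k. E \<inter> {z. \<bar>fst z\<bar> \<le> real k}) = 0"
    by (rule hausdorff_null_UN)
  moreover have "(\<Union>k. E \<inter> {z. \<bar>fst z\<bar> \<le> real k}) = E"
    using real_arch_simple by blast
  ultimately show ?thesis by (simp add: E_def)
qed

text \<open>
  Each summand is convex, and the one whose kink lies strictly between \<open>x\<close> and \<open>y\<close> satisfies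
  the convexity inequality strictly at every intermediate point.
\<close>
lemma strictly_convex_kinked:
  assumes dense: "\<And>x y. 0 \<le> x \<Longrightarrow> x < y \<Longrightarrow> y \<le> 1 \<Longrightarrow> \<exists>n. x < q n \<and> q n < y"
  shows "strictly_convex_on {0..1} kinked"
  unfolding strictly_convex_on_def
proof (intro conjI ballI allI impI)
  fix x y t :: real
  assume xy: "x \<in> {0..1}" "y \<in> {0..1}" and t: "x \<noteq> y \<and> 0 < t \<and> t < 1"
  define z where "z = (1 - t) *\<^sub>R x + t *\<^sub>R y"
  define gap where "gap n = (1 - t) * \<bar>x - q n\<bar> + t * \<bar>y - q n\<bar> - \<bar>z - q n\<bar>" for n
  have z: "z - q n = (1 - t) * (x - q n) + t * (y - q n)" for n
    by (simp add: z_def algebra_simps)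
  have gap_nonneg: "0 \<le> gap n" for n
    using abs_triangle_ineq[of "(1 - t) * (x - q n)" "t * (y - q n)"] t
    by (simp add: gap_def z abs_mult)
  obtain k where k: "min x y < q k" "q k < max x y"
  proof -
    have "min x y < max x y" "0 \<le> min x y" "max x y \<le> 1"
      using xy t by (auto simp: min_less_iff_disj less_max_iff_disj)
    then show thesis
      using dense[of "min x y" "max x y"] that by blast
  qed
  have gap_pos: "0 < gap k"
  proof (cases "x < y")
    case True
    then have "0 < (1 - t) * (q k - x)" "0 < t * (y - q k)"
      using k t by auto
    then show ?thesis
      using k True unfolding gap_def z by (simp add: abs_if algebra_simps)
  next
    case False
    then have "0 < (1 - t) * (x - q k)" "0 < t * (q k - y)"
      using k t by auto
    then show ?thesis
      using k False unfolding gap_def z by (simp add: abs_if algebra_simps)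
  qed
  have sums: "(\<lambda>n. weight n * \<bar>x - q n\<bar>) sums kinked x" for x
    using summable_tail[of 0 x] by (simp add: kinked_def summable_sums)
  have "(\<lambda>n. (1 - t) * (weight n * \<bar>x - q n\<bar>) + t * (weight n * \<bar>y - q n\<bar>) - weight n * \<bar>z - q n\<bar>)
      sums ((1 - t) * kinked x + t * kinked y - kinked z)"
    by (intro sums_diff sums_add sums_mult sums)
  then have gap_sums: "(\<lambda>n. weight n * gap n) sums ((1 - t) * kinked x + t * kinked y - kinked z)"
    by (simp add: gap_def algebra_simps)
  have "0 < (\<Sum>n. weight n * gap n)"
  proof (rule suminf_pos2)
    show "summable (\<lambda>n. weight n * gap n)"
      using gap_sums by (rule sums_summable)
    show "0 \<le> weight n * gap n" for n
      using weight_pos[of n] gap_nonneg[of n] by simp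
    show "0 < weight k * gap k"
      using weight_pos gap_pos by simp
  qed
  then show "kinked ((1 - t) *\<^sub>R x + t *\<^sub>R y) < (1 - t) * kinked x + t * kinked y"
    using sums_unique[OF gap_sums] by (simp add: z_def)
qed simp

end

section \<open>The dimension of the union of the tangent lines\<close>

text \<open>
  By convexity the difference quotients at \<open>0\<close> increase, so they converge to their infimum. This
  guarantees that there is a tangent line at all.
\<close>
lemma strictly_convex_has_right_derivative_0:
  assumes "strictly_convex_on {0..1} F"
  obtains d where "has_right_derivative F d 0"
proof -
  define Q where "Q y = ereal ((F y - F 0) / (y - 0))" for y
  have Q_mono: "Q y \<le> Q y'" if "0 < y" "y < y'" "y' \<le> 1" for y y'
  proof -
    have t: "0 < y / y'" "y / y' < 1"
      using that by auto
    have "F ((1 - y / y') *\<^sub>R 0 + (y / y') *\<^sub>R y') < (1 - y / y') * F 0 + (y / y') * F y'"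
      using assms[unfolded strictly_convex_on_def, THEN conjunct2, rule_format, of 0 y' "y / y'"] that t
      by auto
    then have "F y - F 0 \<le> (y / y') * (F y' - F 0)"
      using that by (simp add: algebra_simps)
    then show ?thesis
      using that by (simp add: Q_def field_simps)
  qed
  define d where "d = (INF y\<in>{0<..1}. Q y)"
  have "(Q \<longlongrightarrow> d) (at_right 0)"
  proof (rule order_tendstoI)
    fix a assume "a < d"
    have "a < Q y" if "0 < y" "y < 1" for y
    proof -
      have "d \<le> Q y" unfolding d_def by (rule INF_lower) (use that in auto)
      with \<open>a < d\<close> show ?thesis by simp
    qed
    then show "\<forall>\<^sub>F y in at_right 0. a < Q y"
      unfolding eventually_at_right_field by (intro exI[of _ 1]) auto
  next
    fix a assume "d < a"
    then obtain y' where y': "0 < y'" "y' \<le> 1" "Q y' < a"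
      unfolding d_def by (auto simp: INF_less_iff)
    then have "Q y < a" if "0 < y" "y < y'" for y
      using Q_mono[of y y'] that by auto
    then show "\<forall>\<^sub>F y in at_right 0. Q y < a"
      unfolding eventually_at_right_field using y'(1) by (intro exI[of _ y']) auto
  qed
  then show thesis
    using that unfolding has_right_derivative_def Q_def by blast
qed

lemma hausdorff_dimension_eq_1I:
  assumes "\<And>s. 1 < s \<Longrightarrow> hausdorff_outer_measure s A = 0"
    and "\<And>s. 0 \<le> s \<Longrightarrow> s < 1 \<Longrightarrow> hausdorff_outer_measure s A \<noteq> 0"
  shows "hausdorff_dimension A = 1"
proof (rule antisym)
  have "hausdorff_dimension A \<le> 1 + ennreal e" if "0 < e" for e
  proof -
    have "hausdorff_dimension A \<le> ennreal (1 + e)"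
      unfolding hausdorff_dimension_def using that assms(1)[of "1 + e"]
      by (intro Inf_lower CollectI exI[of _ "1 + e"]) auto
    also have "ennreal (1 + e) = 1 + ennreal e"
      using that by simp
    finally show ?thesis .
  qed
  then show "hausdorff_dimension A \<le> 1"
    by (rule ennreal_le_epsilon)
  show "1 \<le> hausdorff_dimension A"
    unfolding hausdorff_dimension_def
  proof (rule Inf_greatest)
    fix z assume "z \<in> {ennreal s | s. 0 \<le> s \<and> hausdorff_outer_measure s A = 0}"
    then obtain s where s: "z = ennreal s" "0 \<le> s" "hausdorff_outer_measure s A = 0"
      by blast
    then have "1 \<le> s"
      using assms(2) not_less by blast
    then show "1 \<le> z"
      unfolding s(1) ennreal_1[symmetric] by (rule ennreal_leI)
  qed
qed

theorem theorem2p3: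
  shows "\<exists>F :: real \<Rightarrow> real. strictly_convex_on {0..1} F \<and>
           hausdorff_dimension (\<Union> (one_sided_tangent_lines F)) = 1"
proof -
  define q where "q = from_nat_into (\<rat> \<inter> {0..1::real})"
  have nonempty: "\<rat> \<inter> {0..1::real} \<noteq> {}"
    using Rats_0 by force
  have countable: "countable (\<rat> \<inter> {0..1::real})"
    by (simp add: countable_rat)
  have q_range: "q n \<in> {0..1}" for n
    using from_nat_into[OF nonempty, of n] by (simp add: q_def)
  have dense: "\<exists>n. x < q n \<and> q n < y" if xy: "0 \<le> x" "x < y" "y \<le> 1" for x y
  proof -
    obtain a where "a \<in> \<rat>" "x < a" "a < y"
      using Rats_dense_in_real[OF xy(2)] by blast
    moreover from this xy obtain n where "q n = a"
      using from_nat_into_surj[OF countable, of a] by (auto simp: q_def)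
    ultimately show ?thesis by blast
  qed
  have convex: "strictly_convex_on {0..1} (kinked q)"
    using strictly_convex_kinked[of q] q_range dense by blast
  then obtain d where d: "has_right_derivative (kinked q) d 0"
    by (rule strictly_convex_has_right_derivative_0)
  obtain r where r: "d = ereal r"
    using right_derivative_near_piece[of q, OF q_range d] by metis
  have "line_with_slope (0, kinked q 0) d \<in> one_sided_tangent_lines (kinked q)"
    using d unfolding one_sided_tangent_lines_def by auto
  moreover have "fst ` line_with_slope (0, kinked q 0) d = UNIV"
    by (auto simp: r line_with_slope_def image_iff)
  ultimately have "fst ` \<Union>(one_sided_tangent_lines (kinked q)) = UNIV"
    by blast
  then have "hausdorff_dimension (\<Union>(one_sided_tangent_lines (kinked q))) = 1"
    by (intro hausdorff_dimension_eq_1I tangent_lines_null[of q, OF q_range]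
        hausdorff_not_null_if_projection_UNIV)
  with convex show ?thesis by blast
qed

end
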